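(* Let $p\ge3$ be an integer, let $A$ be a fixed zero-diagonal representative of an $\mathrm{SBIBD}(v,k,\lambda)$, and let $k\ge\lambda(p-1)+2$. Suppose that $A$ contains at least one pairwise separated set of size $p$. Then $$q^*(A,p)=\begin{cases}\lambda(p-1)+2,&\text{if at least one pairwise separated set of size }p\text{ admits a private target permutation},\\ \lambda(p-1)+1,&\text{otherwise}.\end{cases}$$
   Context: Symmetric design. For integers $1\le\lambda<k<v$, an $\mathrm{SBIBD}(v,k,\lambda)$ consists of $v$ points and $v$ blocks such that every block contains $k$ points, every point lies in $k$ blocks, and every two distinct points lie together in exactly $\lambda$ blocks. After independently labeling points and blocks by $0,1,\dots,v-1$, the incidence matrix $A=(A_{ij})\in\{0,1\}^{v\times v}$, with $A_{ij}=1$ iff point $i$ lies in block $j$, is called a representative of the SBIBD. It is zero-diagonal if $A_{ii}=0$ for all $i$. Coding model. There are $v$ nodes $0,\dots,v-1$. For a node $i$ let $\mathcal S_{\mathrm{tgt}}(i)=\{j:A_{ij}=1\}$ (admissible targets) and $\mathcal S_{\mathrm{src}}(i)=\{h:A_{hi}=1\}$ (sources); both have size $k$. There is a finite collection of data objects, each a binary word of one common positive length; $\oplus$ is componentwise addition over $\mathbb F_2$. Each object $x$ has exactly one primary copy, stored at its primary node $i$, and for the replica count $q\in\{0,\dots,k\}$ it selects a set $T_x\subseteq\mathcal S_{\mathrm{tgt}}(i)$ of exactly $q$ distinct target nodes (chosen separately for each object) and sends one replica to each node in $T_x$. A placement is legal if at each node $j$ the replicas received at $j$ are partitioned into $k$-tuples,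 each containing exactly one replica from every primary node in $\mathcal S_{\mathrm{src}}(j)$ (the partition is part of the placement). For each such tuple, consisting of objects $x_1,\dots,x_k$, node $j$ stores one parity $x_1\oplus\cdots\oplus x_k$; the replicas are then discarded. Failures and recovery. Given a set $F$ of failed nodes, all primary copies and parities stored at nodes of $F$ are lost, and those stored at other nodes are alive. A placement permits recovery from $F$ if the values of all objects whose primary node is in $F$ are uniquely determined by the alive primary copies and the alive parities (the placement being known). Universal replica threshold. For an integer $p\ge1$, $q^*(A,p)$ is the smallest integer $q\in\{0,1,\dots,k\}$ such that every legal placement of any finite object collection using exactly $q$ target nodes per object permits recovery from every set of at most $p$ failed nodes. Pairwise separated set. For $F\subseteq\{0,\dots,v-1\}$ and $t\in\{0,\dots,v-1\}$ let $d_F(t)=\sum_{i\in F}A_{it}$. The set $F$ is pairwise separated if $d_F(t)\le2$ for every $t\in\{0,\dots,v-1\}$. Private target permutation. A pairwise separated set $F$ with $|F|=p$ admits a private target permutation if there is a permutation $\sigma:F\to F$ such that $\sigma(i)\in\mathcal S_{\mathrm{tgt}}(i)$ and $d_F(\sigma(i))=1$ for every $i\in F$. *)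

theory Defs
  imports "Jordan_Normal_Form.Matrix" "HOL-Library.Z2" "HOL-Library.Disjoint_Sets"
begin

section \<open>Symmetric designs and their representatives\<close>

text \<open>Blocks are abstract objects related to points by an incidence relation, so they are not
  assumed in advance to be distinct as point sets.\<close>

definition sbibd ::
  "nat \<Rightarrow> nat \<Rightarrow> nat \<Rightarrow> 'a set \<Rightarrow> 'b set \<Rightarrow> ('a \<Rightarrow> 'b \<Rightarrow> bool) \<Rightarrow> bool" where
  "sbibd v k lam P B inc \<longleftrightarrow>
     1 \<le> lam \<and> lam < k \<and> k < v \<and>
     finite P \<and> card P = v \<and> finite B \<and> card B = v \<and>
     (\<forall>b\<in>B. card {x \<in> P. inc x b} = k) \<and>
     (\<forall>x\<in>P. card {b \<in> B. inc x b} = k) \<and>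
     (\<forall>x\<in>P. \<forall>y\<in>P. x \<noteq> y \<longrightarrow> card {b \<in> B. inc x b \<and> inc y b} = lam)"

definition representative ::
  "nat \<Rightarrow> 'a set \<Rightarrow> 'b set \<Rightarrow> ('a \<Rightarrow> 'b \<Rightarrow> bool) \<Rightarrow> nat mat \<Rightarrow> bool" where
  "representative v P B inc A \<longleftrightarrow>
     A \<in> carrier_mat v v \<and>
     (\<exists>f g. bij_betw f P {0..<v} \<and> bij_betw g B {0..<v} \<and>
        (\<forall>x\<in>P. \<forall>b\<in>B. A $$ (f x, g b) = (if inc x b then 1 else 0)))"

definition zero_diagonal :: "nat mat \<Rightarrow> bool" where
  "zero_diagonal A \<longleftrightarrow> (\<forall>i<dim_row A. A $$ (i, i) = 0)"


section \<open>Coding model\<close>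

definition nodes :: "nat mat \<Rightarrow> nat set" where
  "nodes A = {0..<dim_row A}"

definition S_tgt :: "nat mat \<Rightarrow> nat \<Rightarrow> nat set" where
  "S_tgt A i = {j \<in> nodes A. A $$ (i, j) = 1}"

definition S_src :: "nat mat \<Rightarrow> nat \<Rightarrow> nat set" where
  "S_src A i = {h \<in> nodes A. A $$ (h, i) = 1}"

text \<open>Objects are named by natural numbers, so distinct objects may carry the same word. An object
  sends at most one replica to a given node, so the replicas received at a node are identified with
  the objects they copy; \<open>tuples j\<close> is the partition of the replicas received at node \<open>j\<close>.
  The words themselves are not part of the placement, only their common length is.\<close>

record placement =
  objects :: "nat set"
  word_length :: nat
  primary :: "nat \<Rightarrow> nat"
  targets :: "nat \<Rightarrow> nat set"
  tuples :: "nat \<Rightarrow> nat set set"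

definition received :: "placement \<Rightarrow> nat \<Rightarrow> nat set" where
  "received L j = {x \<in> objects L. j \<in> targets L x}"

definition legal_placement :: "nat mat \<Rightarrow> nat \<Rightarrow> nat \<Rightarrow> placement \<Rightarrow> bool" where
  "legal_placement A k q L \<longleftrightarrow>
     finite (objects L) \<and> word_length L > 0 \<and>
     (\<forall>x\<in>objects L. primary L x \<in> nodes A \<and>
        targets L x \<subseteq> S_tgt A (primary L x) \<and> card (targets L x) = q) \<and>
     (\<forall>j\<in>nodes A. partition_on (received L j) (tuples L j) \<and>
        (\<forall>T\<in>tuples L j. card T = k \<and>
           (\<forall>h\<in>S_src A j. \<exists>!x. x \<in> T \<and> primary L x = h)))"

definition valuation :: "placement \<Rightarrow> (nat \<Rightarrow> bit vec) \<Rightarrow> bool" where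
  "valuation L w \<longleftrightarrow> (\<forall>x\<in>objects L. w x \<in> carrier_vec (word_length L))"

definition parity_word :: "placement \<Rightarrow> (nat \<Rightarrow> bit vec) \<Rightarrow> nat set \<Rightarrow> bit vec" where
  "parity_word L w T = vec (word_length L) (\<lambda>b. \<Sum>x\<in>T. w x $ b)"

definition same_alive_data ::
  "nat mat \<Rightarrow> placement \<Rightarrow> nat set \<Rightarrow> (nat \<Rightarrow> bit vec) \<Rightarrow> (nat \<Rightarrow> bit vec) \<Rightarrow> bool" where
  "same_alive_data A L F w w' \<longleftrightarrow>
     (\<forall>x\<in>objects L. primary L x \<notin> F \<longrightarrow> w x = w' x) \<and>
     (\<forall>j\<in>nodes A - F. \<forall>T\<in>tuples L j. parity_word L w T = parity_word L w' T)"

definition permits_recovery :: "nat mat \<Rightarrow> placement \<Rightarrow> nat set \<Rightarrow> bool" where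
  "permits_recovery A L F \<longleftrightarrow>
     (\<forall>w w'. valuation L w \<longrightarrow> valuation L w' \<longrightarrow> same_alive_data A L F w w' \<longrightarrow>
        (\<forall>x\<in>objects L. primary L x \<in> F \<longrightarrow> w x = w' x))"

definition sufficient_counts :: "nat mat \<Rightarrow> nat \<Rightarrow> nat \<Rightarrow> nat set" where
  "sufficient_counts A k p =
     {q \<in> {0..k}. \<forall>L. legal_placement A k q L \<longrightarrow>
        (\<forall>F. F \<subseteq> nodes A \<and> card F \<le> p \<longrightarrow> permits_recovery A L F)}"

text \<open>The value is meaningful only if \<open>sufficient_counts A k p\<close> is nonempty.\<close>

definition q_star :: "nat mat \<Rightarrow> nat \<Rightarrow> nat \<Rightarrow> nat" where
  "q_star A k p = (LEAST q. q \<in> sufficient_counts A k p)"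


section \<open>Pairwise separated sets\<close>

definition deg_in :: "nat mat \<Rightarrow> nat set \<Rightarrow> nat \<Rightarrow> nat" where
  "deg_in A F t = (\<Sum>i\<in>F. A $$ (i, t))"

definition pairwise_separated :: "nat mat \<Rightarrow> nat set \<Rightarrow> bool" where
  "pairwise_separated A F \<longleftrightarrow> F \<subseteq> nodes A \<and> (\<forall>t\<in>nodes A. deg_in A F t \<le> 2)"

definition private_target_permutation :: "nat mat \<Rightarrow> nat set \<Rightarrow> bool" where
  "private_target_permutation A F \<longleftrightarrow>
     (\<exists>\<sigma>. bij_betw \<sigma> F F \<and> (\<forall>i\<in>F. \<sigma> i \<in> S_tgt A i \<and> deg_in A F (\<sigma> i) = 1))"

end

theory Submission
  imports Defs "HOL-Library.Nat_Bijection"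
begin

text \<open>Upper bound: let two data assignments agree on everything that survives the loss of \<open>F\<close>, and
  let \<open>F'\<close> be the set of primary nodes of the objects on which they differ. A differing object can
  only target nodes of \<open>F\<close> and nodes \<open>t\<close> with \<open>d_F'(t) \<ge> 2\<close>, since an alive tuple containing it must
  contain a second differing object. Each \<open>i \<in> F'\<close> has at most \<open>\<lambda>(|F'| - 1)\<close> targets of degree at least 2,
  and the targets of degree 1 inside \<open>F\<close> are distinct for distinct \<open>i\<close>, so
  \<open>|F'| q \<le> |F'| \<lambda>(|F'| - 1) + |F|\<close>. The equality case is a separated set with a private target permutation.

  Lower bound: every node is the primary node of one object for each of its \<open>q\<close>-sets of targets. For \<open>i\<close> in a
  separated set \<open>F\<close>, the differing objects are those whose targets lie in the set \<open>M i\<close> of targets of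
  degree 2, enlarged by the private target if there is one. At an alive node two or no nodes of \<open>F\<close> send
  differing objects, the two equally many by symmetry, so the tuples can pair them up and the differences
  cancel.\<close>

text \<open>A numbering of \<open>R\<close> that lists \<open>W\<close> first. Matching replicas of
  different senders by index then makes differing ones meet differing ones.\<close>

lemma ex_bij_betw_initial:
  assumes "finite R" "W \<subseteq> R"
  shows "\<exists>\<beta>. bij_betw \<beta> R {..<card R} \<and> (\<forall>x\<in>R. x \<in> W \<longleftrightarrow> \<beta> x < card W)"
proof -
  have finW: "finite W"
    using assms finite_subset by blast
  obtain g where g: "bij_betw g W {..<card W}"
    using ex_bij_betw_finite_nat[OF finW] by (auto simp: atLeast0LessThan)
  have "finite (R - W)" "card (R - W) = card {card W..<card R}"
    using assms finW by (auto simp: card_Diff_subset)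
  then obtain h where h: "bij_betw h (R - W) {card W..<card R}"
    using finite_same_card_bij by blast
  have le: "card W \<le> card R"
    using assms by (simp add: card_mono)
  define \<beta> where "\<beta> x = (if x \<in> W then g x else h x)" for x
  have "bij_betw \<beta> W {..<card W}"
    using g by (rule bij_betw_cong[THEN iffD1, rotated]) (simp add: \<beta>_def)
  moreover have "bij_betw \<beta> (R - W) {card W..<card R}"
    using h by (rule bij_betw_cong[THEN iffD1, rotated]) (simp add: \<beta>_def)
  ultimately have "bij_betw \<beta> (W \<union> (R - W)) ({..<card W} \<union> {card W..<card R})"
    by (rule bij_betw_combine) auto
  moreover have "W \<union> (R - W) = R" "{..<card W} \<union> {card W..<card R} = {..<card R}"
    using assms le by auto
  moreover have "x \<in> W \<longleftrightarrow> \<beta> x < card W" if "x \<in> R" for x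
    using bij_betwE[OF g] bij_betwE[OF h] that by (force simp: \<beta>_def)
  ultimately show ?thesis
    by auto
qed

text \<open>A bijection from \<open>X\<close> to \<open>Y\<close> that fixes \<open>j\<close>
  carries one family to the other. This symmetry makes two senders contribute equally many replicas
  at \<open>j\<close>.\<close>

lemma card_subsets_containing_cong:
  assumes "finite X" "finite Y" "card X = card Y" "j \<in> X" "j \<in> Y"
  shows "card {T. T \<subseteq> X \<and> card T = q \<and> j \<in> T} = card {T. T \<subseteq> Y \<and> card T = q \<and> j \<in> T}"
proof -
  have "card (X - {j}) = card (Y - {j})"
    using assms by simp
  then obtain g where g: "bij_betw g (X - {j}) (Y - {j})"
    using assms finite_same_card_bij by blast
  define f where "f x = (if x = j then j else g x)" for x
  have "bij_betw f (X - {j}) (Y - {j})"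
    using g by (rule bij_betw_cong[THEN iffD1, rotated]) (simp add: f_def)
  then have "bij_betw f ((X - {j}) \<union> {j}) ((Y - {j}) \<union> {j})"
    by (rule bij_betw_combine) (auto simp: f_def)
  moreover have "(X - {j}) \<union> {j} = X" "(Y - {j}) \<union> {j} = Y"
    using assms by auto
  ultimately have f: "bij_betw f X Y"
    by simp
  have fj: "f j = j"
    by (simp add: f_def)
  \<comment> \<open>Stated for any bijection fixing \<open>j\<close>, so that it applies to
    \<open>f\<close> and to its inverse.\<close>
  have le: "card {T. T \<subseteq> X \<and> card T = q \<and> j \<in> T} \<le> card {T. T \<subseteq> Y \<and> card T = q \<and> j \<in> T}"
    if "bij_betw f X Y" "f j = j" "finite Y" for f and X Y :: "'a set"
  proof (rule card_inj_on_le)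
    have inj: "inj_on f X"
      using that by (simp add: bij_betw_def)
    show "inj_on ((`) f) {T. T \<subseteq> X \<and> card T = q \<and> j \<in> T}"
      by (rule inj_on_subset[OF inj_on_image_Pow[OF inj]]) auto
    show "(`) f ` {T. T \<subseteq> X \<and> card T = q \<and> j \<in> T} \<subseteq> {T. T \<subseteq> Y \<and> card T = q \<and> j \<in> T}"
    proof safe
      fix T x assume T: "T \<subseteq> X" "j \<in> T"
      show "x \<in> T \<Longrightarrow> f x \<in> Y"
        using T that(1) by (auto simp: bij_betw_def)
      show "card (f ` T) = card T"
        using inj T by (intro card_image) (rule inj_on_subset)
      show "j \<in> f ` T"
        using T that(2) by (metis imageI)
    qed
    show "finite {T. T \<subseteq> Y \<and> card T = q \<and> j \<in> T}"
      using that(3) by simp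
  qed
  have "inv_into X f j = j"
    using bij_betw_inv_into_left[OF f assms(4)] fj by simp
  then show ?thesis
    using le[OF f fj assms(2)] le[OF bij_betw_inv_into[OF f] _ assms(1)] by simp
qed

text \<open>The design in labelled form; the condition on pairs of points becomes the intersection
  number of two rows.\<close>

locale design_matrix =
  fixes v k lam :: nat and A :: "nat mat"
  assumes dim: "A \<in> carrier_mat v v"
    and zero_one: "\<And>i j. i < v \<Longrightarrow> j < v \<Longrightarrow> A $$ (i, j) = 0 \<or> A $$ (i, j) = 1"
    and diag: "\<And>i. i < v \<Longrightarrow> A $$ (i, i) = 0"
    and card_S_src: "\<And>j. j < v \<Longrightarrow> card (S_src A j) = k"
    and card_S_tgt: "\<And>i. i < v \<Longrightarrow> card (S_tgt A i) = k"
    and card_S_tgt_Int: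
      "\<And>i h. i < v \<Longrightarrow> h < v \<Longrightarrow> i \<noteq> h \<Longrightarrow> card (S_tgt A i \<inter> S_tgt A h) = lam"
    and lam_pos: "1 \<le> lam"
    and lam_less: "lam < k"
begin

lemma nodes_eq: "nodes A = {0..<v}"
  using dim by (auto simp: nodes_def)

lemma finite_S_tgt [simp]: "finite (S_tgt A i)"
  by (simp add: S_tgt_def nodes_eq)

lemma finite_S_src [simp]: "finite (S_src A i)"
  by (simp add: S_src_def nodes_eq)

lemma S_tgt_subset: "S_tgt A i \<subseteq> nodes A"
  by (auto simp: S_tgt_def)

lemma not_in_own_S_tgt: "i \<in> nodes A \<Longrightarrow> i \<notin> S_tgt A i"
  using diag by (auto simp: S_tgt_def nodes_eq)

lemma mem_S_src_iff:
  "h \<in> nodes A \<Longrightarrow> j \<in> nodes A \<Longrightarrow> h \<in> S_src A j \<longleftrightarrow> j \<in> S_tgt A h"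
  by (auto simp: S_src_def S_tgt_def)

lemma finite_subset_nodes: "F \<subseteq> nodes A \<Longrightarrow> finite F"
  by (auto simp: nodes_eq intro: finite_subset)

lemma deg_in_eq_card:
  assumes "F \<subseteq> nodes A" "j \<in> nodes A"
  shows "deg_in A F j = card {i \<in> F. j \<in> S_tgt A i}"
proof -
  have "deg_in A F j = (\<Sum>i\<in>F. if j \<in> S_tgt A i then 1 else 0)"
    unfolding deg_in_def
    by (rule sum.cong) (use assms zero_one in \<open>force simp: S_tgt_def nodes_eq\<close>)+
  also have "\<dots> = card {i \<in> F. j \<in> S_tgt A i}"
    using finite_subset_nodes[OF assms(1)] by (simp add: sum.If_cases Int_def)
  finally show ?thesis .
qed

lemma deg_in_pos:
  assumes "F \<subseteq> nodes A" "i \<in> F" "j \<in> S_tgt A i"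
  shows "1 \<le> deg_in A F j"
proof -
  have "card {i} \<le> card {i \<in> F. j \<in> S_tgt A i}"
    by (rule card_mono) (use assms finite_subset_nodes in auto)
  then show ?thesis
    using assms S_tgt_subset by (subst deg_in_eq_card) auto
qed

lemma deg_in_ge_2:
  assumes "F \<subseteq> nodes A" "i \<in> F" "h \<in> F" "i \<noteq> h" "j \<in> S_tgt A i" "j \<in> S_tgt A h"
  shows "2 \<le> deg_in A F j"
proof -
  have "card {i, h} \<le> card {i \<in> F. j \<in> S_tgt A i}"
    by (rule card_mono) (use assms finite_subset_nodes in auto)
  then show ?thesis
    using assms S_tgt_subset by (subst deg_in_eq_card) auto
qed

text \<open>Double counting of the pairs \<open>(j, h)\<close> with \<open>h\<close> in
  \<open>F - {i}\<close> and \<open>j\<close> a common target of \<open>i\<close> and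
  \<open>h\<close>: every \<open>h\<close> contributes \<open>lam\<close>. Each degree counts
  \<open>i\<close> itself, so the subtraction on naturals is exact.\<close>

lemma sum_deg_in_minus_one:
  assumes F: "F \<subseteq> nodes A" and i: "i \<in> F"
  shows "(\<Sum>j\<in>S_tgt A i. deg_in A F j - 1) = lam * (card F - 1)"
proof -
  have fin: "finite F"
    using F by (rule finite_subset_nodes)
  have "deg_in A F j - 1 = (\<Sum>h\<in>F - {i}. if j \<in> S_tgt A h then 1 else 0)"
    if j: "j \<in> S_tgt A i" for j
  proof -
    have "{h \<in> F. j \<in> S_tgt A h} = insert i {h \<in> F - {i}. j \<in> S_tgt A h}"
      using i j by auto
    then have "deg_in A F j = Suc (card {h \<in> F - {i}. j \<in> S_tgt A h})"
      using F j S_tgt_subset fin by (subst deg_in_eq_card) auto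
    then show ?thesis
      using fin by (simp add: sum.If_cases Int_def)
  qed
  then have "(\<Sum>j\<in>S_tgt A i. deg_in A F j - 1)
      = (\<Sum>j\<in>S_tgt A i. \<Sum>h\<in>F - {i}. if j \<in> S_tgt A h then 1 else 0)"
    by simp
  also have "\<dots> = (\<Sum>h\<in>F - {i}. \<Sum>j\<in>S_tgt A i. if j \<in> S_tgt A h then 1 else 0)"
    by (rule sum.swap)
  also have "\<dots> = (\<Sum>h\<in>F - {i}. lam)"
  proof (rule sum.cong)
    fix h assume "h \<in> F - {i}"
    then have "card (S_tgt A i \<inter> S_tgt A h) = lam"
      using F i by (intro card_S_tgt_Int) (auto simp: nodes_eq)
    then show "(\<Sum>j\<in>S_tgt A i. if j \<in> S_tgt A h then 1 else 0) = lam"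
      by (simp add: sum.If_cases)
  qed simp
  also have "\<dots> = lam * (card F - 1)"
    using i fin by simp
  finally show ?thesis .
qed

section \<open>Targets of degree one and of degree at least two\<close>

definition shared_targets :: "nat set \<Rightarrow> nat \<Rightarrow> nat set" where
  "shared_targets F i = {j \<in> S_tgt A i. 2 \<le> deg_in A F j}"

definition private_targets :: "nat set \<Rightarrow> nat \<Rightarrow> nat set" where
  "private_targets F i = {j \<in> S_tgt A i. deg_in A F j = 1}"

lemma finite_shared_targets [simp]: "finite (shared_targets F i)"
  by (simp add: shared_targets_def)

lemma finite_private_targets [simp]: "finite (private_targets F i)"
  by (simp add: private_targets_def)

lemma card_shared_targets_eq_sum:
  "card (shared_targets F i) = (\<Sum>j\<in>S_tgt A i. if 2 \<le> deg_in A F j then 1 else 0)"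
  by (simp add: shared_targets_def sum.If_cases Int_def)

text \<open>The indicator of degree at least 2 is termwise below the summand of
  \<open>sum_deg_in_minus_one\<close>.\<close>

lemma card_shared_targets_le:
  assumes "F \<subseteq> nodes A" "i \<in> F"
  shows "card (shared_targets F i) \<le> lam * (card F - 1)"
  unfolding card_shared_targets_eq_sum sum_deg_in_minus_one[OF assms, symmetric]
  by (rule sum_mono) auto

text \<open>Equality of the two sums forces equality in every term, and an indicator is at most
  1.\<close>

lemma deg_in_le_2_if_card_shared_targets:
  assumes "F \<subseteq> nodes A" "i \<in> F" "card (shared_targets F i) = lam * (card F - 1)"
    and "j \<in> S_tgt A i"
  shows "deg_in A F j \<le> 2"
proof -
  have "(if 2 \<le> deg_in A F j then 1 else 0) = deg_in A F j - 1"
  proof (rule sum_mono_inv[where f = "\<lambda>j. if 2 \<le> deg_in A F j then 1 else 0"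
        and g = "\<lambda>j. deg_in A F j - 1"])
    show "(\<Sum>j\<in>S_tgt A i. if 2 \<le> deg_in A F j then 1 else 0)
        = (\<Sum>j\<in>S_tgt A i. deg_in A F j - 1)"
      using assms(3) unfolding card_shared_targets_eq_sum sum_deg_in_minus_one[OF assms(1,2)] .
  qed (use assms(4) in auto)
  then show ?thesis
    by (auto split: if_splits)
qed

text \<open>All targets have degree 1 or 2 here, where the indicator equals the degree minus
  one.\<close>

lemma card_shared_targets_separated:
  assumes "pairwise_separated A F" "i \<in> F"
  shows "card (shared_targets F i) = lam * (card F - 1)"
proof -
  have F: "F \<subseteq> nodes A" and le: "\<And>j. j \<in> nodes A \<Longrightarrow> deg_in A F j \<le> 2"
    using assms(1) by (auto simp: pairwise_separated_def)
  show ?thesis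
    unfolding card_shared_targets_eq_sum sum_deg_in_minus_one[OF F assms(2), symmetric]
  proof (rule sum.cong)
    fix j assume "j \<in> S_tgt A i"
    then have "1 \<le> deg_in A F j" "deg_in A F j \<le> 2"
      using deg_in_pos[OF F assms(2)] le S_tgt_subset by auto
    then show "(if 2 \<le> deg_in A F j then 1 else 0) = deg_in A F j - 1"
      by auto
  qed simp
qed

lemma private_targets_disjoint:
  assumes "F \<subseteq> nodes A" "i \<in> F" "h \<in> F" "i \<noteq> h"
  shows "private_targets F i \<inter> private_targets F h = {}"
  using deg_in_ge_2[OF assms] by (fastforce simp: private_targets_def)

text \<open>Disjoint sets are packed into \<open>F\<close>. Degrees refer to \<open>F'\<close>,
  which in the application is the set of differing primary nodes and may be smaller than the failed
  set \<open>F\<close>.\<close>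

lemma sum_card_private_targets_le:
  assumes "F' \<subseteq> nodes A" "finite F"
  shows "(\<Sum>i\<in>F'. card (private_targets F' i \<inter> F)) \<le> card F"
proof -
  have "(\<Sum>i\<in>F'. card (private_targets F' i \<inter> F))
      = card (\<Union>i\<in>F'. private_targets F' i \<inter> F)"
  proof (rule card_UN_disjoint[symmetric])
    show "\<forall>i\<in>F'. \<forall>h\<in>F'. i \<noteq> h \<longrightarrow>
        (private_targets F' i \<inter> F) \<inter> (private_targets F' h \<inter> F) = {}"
      using private_targets_disjoint[OF assms(1)] by blast
  qed (use finite_subset_nodes[OF assms(1)] in auto)
  also have "\<dots> \<le> card F"
    by (rule card_mono) (use assms in auto)
  finally show ?thesis .
qed


section \<open>Necessary conditions for failing recovery\<close>

text \<open>A surviving parity would change if its tuple held exactly one differing object. So there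
  is a second one, and legality gives it another primary node.\<close>

lemma differing_object_target:
  assumes L: "legal_placement A k q L"
    and w: "valuation L w" "valuation L w'"
    and same: "same_alive_data A L F w w'"
    and U: "U = {x \<in> objects L. w x \<noteq> w' x}"
    and x: "x \<in> U" and j: "j \<in> targets L x" "j \<notin> F"
  shows "2 \<le> deg_in A (primary L ` U) j"
proof -
  have obj: "y \<in> objects L \<Longrightarrow> primary L y \<in> nodes A \<and> targets L y \<subseteq> S_tgt A (primary L y)" for y
    using L by (auto simp: legal_placement_def)
  have xo: "x \<in> objects L"
    using x U by auto
  have jn: "j \<in> nodes A"
    using obj[OF xo] j S_tgt_subset by blast
  have part: "partition_on (received L j) (tuples L j)"
    and tup: "\<And>T h. T \<in> tuples L j \<Longrightarrow> h \<in> S_src A j \<Longrightarrow> \<exists>!y. y \<in> T \<and> primary L y = h"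
    using L jn by (auto simp: legal_placement_def)
  have "x \<in> received L j"
    using xo j by (simp add: received_def)
  then obtain T where T: "T \<in> tuples L j" "x \<in> T"
    using part by (auto simp: partition_on_def)
  have Tr: "T \<subseteq> received L j"
    using part T by (auto simp: partition_on_def)
  have finT: "finite T"
    by (rule finite_subset[OF Tr]) (use L in \<open>auto simp: received_def legal_placement_def\<close>)
  have "\<exists>y\<in>T. y \<in> U \<and> y \<noteq> x"
  proof (rule ccontr)
    assume "\<not> ?thesis"
    then have rest: "\<And>y. y \<in> T - {x} \<Longrightarrow> w y = w' y"
      using Tr U by (auto simp: received_def)
    have car: "w x \<in> carrier_vec (word_length L)" "w' x \<in> carrier_vec (word_length L)"
      using w xo by (auto simp: valuation_def)
    have "w x \<noteq> w' x"
      using x U by auto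
    \<comment> \<open>At this bit position all other summands of the parity agree, so
      \<open>x\<close> alone would change it.\<close>
    then obtain b where b: "b < word_length L" "w x $ b \<noteq> w' x $ b"
      using car by (metis carrier_vecD eq_vecI)
    have "parity_word L w T = parity_word L w' T"
      using same jn j(2) T(1) by (auto simp: same_alive_data_def)
    then have "(\<Sum>y\<in>T. w y $ b) = (\<Sum>y\<in>T. w' y $ b)"
      using b(1) by (metis index_vec parity_word_def)
    moreover have "(\<Sum>y\<in>T - {x}. w y $ b) = (\<Sum>y\<in>T - {x}. w' y $ b)"
      by (rule sum.cong) (use rest in auto)
    ultimately show False
      using b(2) by (metis sum.remove[OF finT T(2)] add_right_cancel)
  qed
  then obtain y where y: "y \<in> T" "y \<in> U" "y \<noteq> x"
    by blast
  have yj: "j \<in> targets L y" "y \<in> objects L"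
    using y Tr by (auto simp: received_def)
  have xt: "j \<in> S_tgt A (primary L x)" and yt: "j \<in> S_tgt A (primary L y)"
    using obj[OF xo] obj[OF yj(2)] j yj by auto
  have "primary L x \<in> S_src A j"
    using mem_S_src_iff[of "primary L x" j] obj[OF xo] jn xt by blast
  \<comment> \<open>A tuple holds only one object from each source, and \<open>x\<close> and
    \<open>y\<close> are different objects.\<close>
  then have "primary L x \<noteq> primary L y"
    using tup[OF T(1)] T(2) y(1,3) by metis
  then show ?thesis
    using deg_in_ge_2[of "primary L ` U" "primary L x" "primary L y" j] x y(2) xt yt obj U
    by blast
qed

text \<open>Used twice: at \<open>lam * (p - 1) + 2\<close> the conclusion on \<open>q\<close> is
  absurd, so recovery holds; at \<open>lam * (p - 1) + 1\<close> a failure yields the separated set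
  with its permutation.\<close>

lemma no_recovery_imp:
  assumes L: "legal_placement A k q L"
    and F: "F \<subseteq> nodes A" "card F \<le> p"
    and fail: "\<not> permits_recovery A L F"
    and q: "lam * (p - 1) + 1 \<le> q"
  shows "q = lam * (p - 1) + 1 \<and> pairwise_separated A F \<and> card F = p \<and>
    private_target_permutation A F"
proof -
  obtain w w' x0 where w: "valuation L w" "valuation L w'"
    and same: "same_alive_data A L F w w'"
    and x0: "x0 \<in> objects L" "w x0 \<noteq> w' x0"
    using fail unfolding permits_recovery_def by blast
  define U where "U = {x \<in> objects L. w x \<noteq> w' x}"
  define F' where "F' = primary L ` U"
  have F'F: "F' \<subseteq> F"
    using same by (auto simp: F'_def U_def same_alive_data_def)
  have F'n: "F' \<subseteq> nodes A"
    using F'F F by blast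
  have finF: "finite F" "finite F'"
    using F F'n finite_subset_nodes by auto
  have target: "2 \<le> deg_in A F' j" if "x \<in> U" "j \<in> targets L x" "j \<notin> F" for x j
    using differing_object_target[OF L w same U_def that] by (simp add: F'_def)
  \<comment> \<open>Both bounds come from the targets of one differing object with primary node
    \<open>i\<close>; the second is for the case that \<open>i\<close> is the only such
    node.\<close>
  have bound: "q \<le> card (shared_targets F' i) + card (private_targets F' i \<inter> F)"
    and q_le: "card F' = 1 \<Longrightarrow> q \<le> card F - 1"
    if "i \<in> F'" for i
  proof -
    obtain x where x: "x \<in> U" "primary L x = i"
      using \<open>i \<in> F'\<close> by (auto simp: F'_def)
    have tx: "targets L x \<subseteq> S_tgt A i" "card (targets L x) = q"
      using L x by (auto simp: legal_placement_def U_def)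
    have "targets L x \<subseteq> shared_targets F' i \<union> private_targets F' i \<inter> F"
    proof
      fix j assume j: "j \<in> targets L x"
      then have "1 \<le> deg_in A F' j"
        using deg_in_pos[OF F'n \<open>i \<in> F'\<close>] tx by blast
      then show "j \<in> shared_targets F' i \<union> private_targets F' i \<inter> F"
        using target[OF x(1) j] tx j by (auto simp: shared_targets_def private_targets_def)
    qed
    then have "q \<le> card (shared_targets F' i \<union> private_targets F' i \<inter> F)"
      unfolding tx(2)[symmetric] by (intro card_mono) auto
    also have "\<dots> \<le> card (shared_targets F' i) + card (private_targets F' i \<inter> F)"
      by (rule card_Un_le)
    finally show "q \<le> card (shared_targets F' i) + card (private_targets F' i \<inter> F)" .
    show "q \<le> card F - 1" if one: "card F' = 1"
    proof -
      \<comment> \<open>With one differing primary node no degree reaches 2, so every target has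
        failed; the zero diagonal excludes \<open>i\<close>.\<close>
      have "targets L x \<subseteq> F - {i}"
      proof
        fix j assume j: "j \<in> targets L x"
        have jn: "j \<in> nodes A"
          using tx(1) j S_tgt_subset by blast
        have "deg_in A F' j \<le> card F'"
          unfolding deg_in_eq_card[OF F'n jn] by (rule card_mono) (use finF in auto)
        then have "j \<in> F"
          using target[OF x(1) j] one by auto
        then show "j \<in> F - {i}"
          using not_in_own_S_tgt[of i] \<open>i \<in> F'\<close> F'n tx(1) j by blast
      qed
      then have "card (targets L x) \<le> card (F - {i})"
        by (intro card_mono) (use finF in auto)
      then show ?thesis
        using tx(2) \<open>i \<in> F'\<close> F'F by (auto simp: finF)
    qed
  qed
  define f where "f = card F'"
  have F'ne: "F' \<noteq> {}"
    using x0 by (auto simp: F'_def U_def)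
  then have f1: "1 \<le> f"
    using finF by (simp add: f_def Suc_le_eq card_gt_0_iff)
  have fF: "f \<le> card F"
    unfolding f_def by (rule card_mono) (use finF F'F in auto)
  \<comment> \<open>For \<open>f = 1\<close> the counting bound alone is too weak; the zero diagonal is needed.\<close>
  have f2: "2 \<le> f"
  proof (rule ccontr)
    assume "\<not> 2 \<le> f"
    then have "q \<le> card F - 1"
      using q_le F'ne f1 by (auto simp: f_def)
    then have "lam * (p - 1) + 1 \<le> p - 1"
      using q F(2) by linarith
    moreover have "p - 1 \<le> lam * (p - 1)"
      using lam_pos by simp
    ultimately show False
      by linarith
  qed
  have "f * q = (\<Sum>i\<in>F'. q)"
    by (simp add: f_def)
  also have "\<dots> \<le> (\<Sum>i\<in>F'. card (shared_targets F' i) + card (private_targets F' i \<inter> F))"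
    by (rule sum_mono) (rule bound)
  also have "\<dots> \<le> (\<Sum>i\<in>F'. lam * (f - 1)) + card F"
    unfolding sum.distrib f_def
    by (intro add_mono sum_mono card_shared_targets_le sum_card_private_targets_le F'n finF)
  finally have count: "f * q \<le> f * (lam * (f - 1)) + card F"
    by (simp add: f_def)
  \<comment> \<open>If \<open>p = f + d\<close> with \<open>d \<ge> 1\<close>, each of the
    \<open>f\<close> nodes needs at least \<open>d\<close> extra targets, while the count leaves
    only \<open>d\<close> in total; this contradicts \<open>f \<ge> 2\<close>.\<close>
  have pf: "f = p"
  proof (rule ccontr)
    assume "f \<noteq> p"
    then obtain d where d: "p = f + d" "1 \<le> d"
      using fF F(2) by (metis le_add_diff_inverse le_trans less_one not_le add.right_neutral)
    have "p - 1 = (f - 1) + d"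
      using d f1 by simp
    then have "lam * (f - 1) + lam * d + 1 \<le> q"
      using q by (simp add: distrib_left)
    moreover have "d \<le> lam * d"
      using lam_pos by simp
    ultimately have "lam * (f - 1) + d + 1 \<le> q"
      by linarith
    then have "f * (lam * (f - 1) + d + 1) \<le> f * q"
      by (rule mult_le_mono2)
    then have "f * (lam * (f - 1) + d + 1) \<le> f * (lam * (f - 1)) + (f + d)"
      using count F(2) d(1) by linarith
    then have "f * d \<le> d"
      by (simp add: distrib_left)
    then show False
      using f2 d(2) by simp
  qed
  then have cardF: "card F = p" and FF': "F' = F"
    using fF F(2) finF F'F by (auto simp: f_def card_subset_eq)
  have "p * q \<le> p * (lam * (p - 1) + 1)"
    using count pf cardF by (simp add: algebra_simps)
  then have "q \<le> lam * (p - 1) + 1"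
    using f1 pf unfolding mult_le_cancel1 by simp
  then have qeq: "q = lam * (p - 1) + 1"
    using q by simp
  have shared_le: "card (shared_targets F i) \<le> lam * (p - 1)" if "i \<in> F" for i
    using card_shared_targets_le[OF F(1) that] cardF by simp
  have priv_ge: "1 \<le> card (private_targets F i \<inter> F)" if "i \<in> F" for i
    using bound[of i] shared_le[OF that] that qeq FF' by simp
  \<comment> \<open>Every term is at least 1 and the sum is at most \<open>card F\<close>, so no
    term exceeds 1.\<close>
  have priv: "card (private_targets F i \<inter> F) = 1" if "i \<in> F" for i
  proof (rule sum_mono_inv[symmetric, where f = "\<lambda>_. 1"
        and g = "\<lambda>i. card (private_targets F i \<inter> F)"])
    show "(\<Sum>i\<in>F. 1) = (\<Sum>i\<in>F. card (private_targets F i \<inter> F))"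
      using sum_mono[of F "\<lambda>_. 1" "\<lambda>i. card (private_targets F i \<inter> F)"] priv_ge
        sum_card_private_targets_le[OF F(1) finF(1)] by simp
  qed (use priv_ge that finF in auto)
  \<comment> \<open>One private target leaves \<open>lam * (p - 1)\<close> of the \<open>q\<close>
    targets, which is the maximum for shared ones.\<close>
  have shared: "card (shared_targets F i) = lam * (card F - 1)" if "i \<in> F" for i
    using bound[of i] shared_le[OF that] that qeq FF' priv[OF that] cardF by simp
  have "deg_in A F t \<le> 2" if t: "t \<in> nodes A" for t
  proof (cases "\<exists>i\<in>F. t \<in> S_tgt A i")
    case True
    then show ?thesis
      using deg_in_le_2_if_card_shared_targets[OF F(1)] shared by blast
  next
    case False
    then have "{i \<in> F. t \<in> S_tgt A i} = {}"
      by blast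
    then show ?thesis
      by (simp only: deg_in_eq_card[OF F(1) t]) simp
  qed
  then have sep: "pairwise_separated A F"
    using F by (simp add: pairwise_separated_def)
  \<comment> \<open>The failed private targets define the permutation: disjointness makes the choice
    injective, and \<open>F\<close> is finite.\<close>
  have "\<forall>i\<in>F. \<exists>j. j \<in> private_targets F i \<inter> F"
    using priv by (metis card.empty equals0I zero_neq_one)
  then obtain \<sigma> where \<sigma>: "\<And>i. i \<in> F \<Longrightarrow> \<sigma> i \<in> private_targets F i \<inter> F"
    by metis
  have "inj_on \<sigma> F"
    using \<sigma> private_targets_disjoint[OF F(1)] by (intro inj_onI) (metis IntD1 IntI empty_iff)
  moreover have "\<sigma> ` F \<subseteq> F"
    using \<sigma> by auto
  ultimately have "bij_betw \<sigma> F F"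
    using endo_inj_surj[OF finF(1)] by (simp add: bij_betw_def)
  then have "private_target_permutation A F"
    using \<sigma> unfolding private_target_permutation_def private_targets_def by blast
  then show ?thesis
    using qeq sep cardF by blast
qed


section \<open>Placements with a failing recovery\<close>

text \<open>\<open>M i\<close> is the set in which differing objects of \<open>i\<close> choose
  their targets. Beyond the shared targets it may contain failed nodes only, so at an alive node of
  \<open>M i\<close> exactly two nodes of \<open>F\<close> send, and both have it in their
  \<open>M\<close>. Keeping \<open>M\<close> general serves both values of the threshold.\<close>

lemma ex_unrecoverable_placement:
  assumes sep: "pairwise_separated A F" and ne: "F \<noteq> {}"
    and M: "\<And>i. i \<in> F \<Longrightarrow> M i \<subseteq> S_tgt A i" "\<And>i. i \<in> F \<Longrightarrow> card (M i) = m"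
    and shared: "\<And>i. i \<in> F \<Longrightarrow> shared_targets F i \<subseteq> M i"
    and alive: "\<And>i j. i \<in> F \<Longrightarrow> j \<in> M i \<Longrightarrow> j \<notin> F \<Longrightarrow> 2 \<le> deg_in A F j"
    and q: "q \<le> m"
  shows "\<exists>L. legal_placement A k q L \<and> \<not> permits_recovery A L F"
proof -
  have F: "F \<subseteq> nodes A" and deg_le: "\<And>j. j \<in> nodes A \<Longrightarrow> deg_in A F j \<le> 2"
    using sep by (auto simp: pairwise_separated_def)

  \<comment> \<open>Objects as codes of pairs of a primary node and a target set\<close>
  define pr where "pr x = fst (prod_decode x)" for x
  define tg where "tg x = set_decode (snd (prod_decode x))" for x
  define enc where "enc h T = prod_encode (h, set_encode T)" for h T
  have pr_enc: "pr (enc h T) = h" for h T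
    by (simp add: pr_def enc_def)
  have tg_enc: "finite T \<Longrightarrow> tg (enc h T) = T" for h T
    by (simp add: tg_def enc_def)
  have enc_tg: "enc (pr x) (tg x) = x" for x
    by (simp add: tg_def pr_def enc_def)
  define Obj where
    "Obj = {x. pr x \<in> nodes A \<and> tg x \<subseteq> S_tgt A (pr x) \<and> card (tg x) = q}"
  have "Obj \<subseteq> (\<lambda>(h, T). enc h T) ` (SIGMA h:nodes A. Pow (S_tgt A h))"
  proof
    fix x assume "x \<in> Obj"
    then have "(pr x, tg x) \<in> (SIGMA h:nodes A. Pow (S_tgt A h))"
      by (auto simp: Obj_def)
    then show "x \<in> (\<lambda>(h, T). enc h T) ` (SIGMA h:nodes A. Pow (S_tgt A h))"
      using enc_tg[of x] by (metis (mono_tags, lifting) case_prod_conv image_eqI)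
  qed
  then have finObj: "finite Obj"
    by (rule finite_subset) (auto simp: nodes_eq)

  \<comment> \<open>Counting all replicas and the differing replicas at a node\<close>
  define R where "R j h = {x \<in> Obj. pr x = h \<and> j \<in> tg x}" for j h
  \<comment> \<open>\<open>U\<close> will be the set of differing objects, and \<open>W j h\<close>
    those of them that \<open>h\<close> sends to \<open>j\<close>.\<close>
  define U where "U = {x \<in> Obj. pr x \<in> F \<and> tg x \<subseteq> M (pr x)}"
  define W where "W j h = R j h \<inter> U" for j h
  have finR: "finite (R j h)" for j h
    using finObj by (simp add: R_def)
  \<comment> \<open>Decoding the target set is a bijection; \<open>X\<close> will be
    \<open>S_tgt A h\<close> for \<open>R\<close> and \<open>M h\<close> for
    \<open>W\<close>.\<close>
  have card_fibre: "card {x \<in> Obj. pr x = h \<and> tg x \<subseteq> X \<and> j \<in> tg x}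
      = card {T. T \<subseteq> X \<and> card T = q \<and> j \<in> T}"
    if "h \<in> nodes A" "X \<subseteq> S_tgt A h" for h X j
  proof (rule bij_betw_same_card, rule bij_betwI)
    have fin: "finite X"
      using that(2) by (rule finite_subset) simp
    have finT: "finite T" if "T \<subseteq> X" for T
      using that fin by (rule finite_subset)
    show "tg \<in> {x \<in> Obj. pr x = h \<and> tg x \<subseteq> X \<and> j \<in> tg x} \<rightarrow> {T. T \<subseteq> X \<and> card T = q \<and> j \<in> T}"
      by (auto simp: Obj_def)
    show "enc h \<in> {T. T \<subseteq> X \<and> card T = q \<and> j \<in> T} \<rightarrow> {x \<in> Obj. pr x = h \<and> tg x \<subseteq> X \<and> j \<in> tg x}"
      using that finT by (fastforce simp: Obj_def pr_enc tg_enc)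
    show "enc h (tg x) = x" if "x \<in> {x \<in> Obj. pr x = h \<and> tg x \<subseteq> X \<and> j \<in> tg x}" for x
      using that enc_tg by auto
    show "tg (enc h T) = T" if "T \<in> {T. T \<subseteq> X \<and> card T = q \<and> j \<in> T}" for T
      using that finT tg_enc by auto
  qed
  have R_eq: "R j h = {x \<in> Obj. pr x = h \<and> tg x \<subseteq> S_tgt A h \<and> j \<in> tg x}" for j h
    by (auto simp: R_def Obj_def)
  have W_eq: "W j h = {x \<in> Obj. pr x = h \<and> tg x \<subseteq> M h \<and> j \<in> tg x}" if "h \<in> F" for j h
    using that by (auto simp: R_def W_def U_def)
  have card_R: "card (R j h) = card (R j h')" if "h \<in> S_src A j" "h' \<in> S_src A j" for j h h'
  proof (cases "j \<in> nodes A")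
    case True
    then have "h \<in> nodes A" "h' \<in> nodes A" "h < v" "h' < v" "j \<in> S_tgt A h" "j \<in> S_tgt A h'"
      using that by (auto simp: S_src_def S_tgt_def nodes_eq)
    then show ?thesis
      by (simp add: R_eq card_fibre card_S_tgt
          card_subsets_containing_cong[of "S_tgt A h" "S_tgt A h'"])
  next
    \<comment> \<open>Outside the nodes nothing is received; covering this case lets
      \<open>n\<close> be chosen for all \<open>j\<close> at once.\<close>
    case False
    then have "R j g = {}" for g
      using S_tgt_subset by (auto simp: R_def Obj_def)
    then show ?thesis
      by simp
  qed
  have card_W: "card (W j h) = card (W j h')"
    if "h \<in> F" "h' \<in> F" "j \<in> M h" "j \<in> M h'" for j h h'
  proof -
    have "finite (M h)" "finite (M h')" "card (M h) = card (M h')" "h \<in> nodes A" "h' \<in> nodes A"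
      using M that F finite_subset[OF M(1)] by auto
    then show ?thesis
      using that M(1) by (simp add: W_eq card_fibre card_subsets_containing_cong[of "M h" "M h'"])
  qed

  \<comment> \<open>Forming the tuples\<close>
  have "\<forall>j h. \<exists>g. bij_betw g (R j h) {..<card (R j h)} \<and>
      (\<forall>x\<in>R j h. x \<in> W j h \<longleftrightarrow> g x < card (W j h))"
    by (intro allI ex_bij_betw_initial finR) (simp add: W_def)
  \<comment> \<open>Tuples are formed by equal \<open>\<beta>\<close>-index; the differing objects come first in every numbering.\<close>
  then obtain \<beta> where
    \<beta>: "\<And>j h. bij_betw (\<beta> j h) (R j h) {..<card (R j h)}"
    and \<beta>_W: "\<And>j h x. x \<in> R j h \<Longrightarrow> x \<in> W j h \<longleftrightarrow> \<beta> j h x < card (W j h)"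
    by metis
  define b where "b j x = \<beta> j (pr x) x" for j x
  \<comment> \<open>All sources of \<open>j\<close> send equally many replicas; this common number
    is the number of tuples at \<open>j\<close>.\<close>
  have "\<forall>j. \<exists>n. \<forall>h\<in>S_src A j. card (R j h) = n"
    using card_R by blast
  then obtain n where n: "\<And>j h. h \<in> S_src A j \<Longrightarrow> card (R j h) = n j"
    by metis
  define rec where "rec j = {x \<in> Obj. j \<in> tg x}" for j
  define cls where "cls j c = {x \<in> rec j. b j x = c}" for j c
  define L where "L = \<lparr>objects = Obj, word_length = 1, primary = pr, targets = tg,
    tuples = (\<lambda>j. cls j ` {..<n j})\<rparr>"
  have L_simps [simp]: "objects L = Obj" "word_length L = 1" "primary L = pr" "targets L = tg"
      "tuples L j = cls j ` {..<n j}" "received L j = rec j" for j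
    by (auto simp: L_def received_def rec_def)

  have rec_src: "pr x \<in> S_src A j" "x \<in> R j (pr x)" if "x \<in> rec j" for x j
    using that by (auto simp: rec_def Obj_def S_src_def S_tgt_def R_def)
  have rec_b: "b j x < n j" if "x \<in> rec j" for x j
    using bij_betwE[OF \<beta>] rec_src[OF that] n by (fastforce simp: b_def)
  have ex_cls: "\<exists>x. x \<in> cls j c \<and> pr x = h" if "h \<in> S_src A j" "c < n j" for j c h
  proof -
    have "c \<in> \<beta> j h ` R j h"
      using \<beta>[of j h] n that by (simp add: bij_betw_def)
    then show ?thesis
      by (auto simp: R_def cls_def rec_def b_def)
  qed
  have cls_unique: "x = y" if "x \<in> cls j c" "y \<in> cls j c" "pr x = pr y" for x y j c
  proof -
    have "x \<in> R j (pr x)" "y \<in> R j (pr x)" "\<beta> j (pr x) x = \<beta> j (pr x) y"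
      using that by (auto simp: R_def cls_def rec_def b_def)
    then show ?thesis
      using \<beta>[of j "pr x"] by (auto simp: bij_betw_def inj_on_def)
  qed
  have ex1_cls: "\<exists>!x. x \<in> cls j c \<and> pr x = h" if "h \<in> S_src A j" "c < n j" for j c h
    using ex_cls[OF that] cls_unique by metis

  \<comment> \<open>Legality of the placement\<close>
  have "legal_placement A k q L"
    unfolding legal_placement_def
  proof (intro conjI ballI)
    fix j assume j: "j \<in> nodes A"
    then have card_src: "card (S_src A j) = k"
      using card_S_src by (simp add: nodes_eq)
    \<comment> \<open>A partition has no empty block, so each class needs at least one
      source.\<close>
    then have "S_src A j \<noteq> {}"
      using lam_less by auto
    then have cls_ne: "cls j c \<noteq> {}" if "c < n j" for c
      using ex_cls that by blast
    show "partition_on (received L j) (tuples L j)"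
    proof (rule partition_onI)
      show "\<Union> (tuples L j) = received L j"
        using rec_b by (auto simp: cls_def)
      show "disjnt X Y" if "X \<in> tuples L j" "Y \<in> tuples L j" "X \<noteq> Y" for X Y
        using that by (auto simp: cls_def disjnt_def)
      show "{} \<notin> tuples L j"
        using cls_ne by auto
    qed
    fix T assume "T \<in> tuples L j"
    then obtain c where c: "T = cls j c" "c < n j"
      by auto
    show "\<exists>!x. x \<in> T \<and> primary L x = h" if "h \<in> S_src A j" for h
      using ex1_cls[OF that c(2)] c(1) by simp
    have "inj_on pr T"
      using cls_unique c by (auto intro: inj_onI)
    moreover have "pr ` T = S_src A j"
      using ex_cls[OF _ c(2)] rec_src c(1) by (fastforce simp: cls_def)
    ultimately show "card T = k"
      using card_src card_image by metis
  qed (use finObj in \<open>auto simp: Obj_def\<close>)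

  \<comment> \<open>Failure of recovery\<close>
  moreover have "\<not> permits_recovery A L F"
  proof
    assume rec: "permits_recovery A L F"
    \<comment> \<open>The indicator of \<open>U\<close>, against the zero assignment
      \<open>w\<close>: alive parities agree exactly when alive tuples meet \<open>U\<close> in an
      even number of objects.\<close>
    define w' where "w' x = vec 1 (\<lambda>_. if x \<in> U then 1 else 0 :: bit)" for x
    define w where "w x = (vec 1 (\<lambda>_. 0) :: bit vec)" for x :: nat
    have "valuation L w" "valuation L w'"
      by (auto simp: valuation_def w_def w'_def)
    moreover have "same_alive_data A L F w w'"
      unfolding same_alive_data_def
    proof (intro conjI ballI impI)
      fix x assume "primary L x \<notin> F"
      then show "w x = w' x"
        by (auto simp: w_def w'_def U_def)
    next
      fix j T assume j: "j \<in> nodes A - F" and "T \<in> tuples L j"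
      then obtain c where c: "T = cls j c" "c < n j"
        by auto
      have finT: "finite T"
        by (rule finite_subset[OF _ finObj]) (auto simp: c cls_def rec_def)
      have "(\<Sum>x\<in>T. if x \<in> U then 1 else 0 :: bit) = 0"
      proof (cases "T \<inter> U = {}")
        case True
        then show ?thesis
          by (intro sum.neutral) auto
      next
        case False
        then obtain x where x: "x \<in> T" "x \<in> U"
          by blast
        define i where "i = pr x"
        have i: "i \<in> F" "j \<in> M i"
          using x c by (auto simp: i_def U_def cls_def rec_def)
        have "deg_in A F j = 2"
          using alive[OF i] deg_le j by (simp add: le_antisym)
        then have "card {h \<in> F. j \<in> S_tgt A h} = 2"
          using deg_in_eq_card[OF F] j by simp
        then obtain g g' where "{h \<in> F. j \<in> S_tgt A h} = {g, g'}" "g \<noteq> g'"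
          by (auto simp: card_2_iff)
        moreover have "i \<in> {h \<in> F. j \<in> S_tgt A h}"
          using i M(1) by auto
        ultimately obtain h where h: "{h \<in> F. j \<in> S_tgt A h} = {i, h}" "h \<noteq> i"
          by (metis empty_iff insert_commute insert_iff)
        then have hF: "h \<in> F" "j \<in> S_tgt A h"
          by auto
        \<comment> \<open>Degree 2 makes \<open>j\<close> a shared target of the other sender
          \<open>h\<close> too, so \<open>h\<close> also has differing replicas to match.\<close>
        have hM: "j \<in> M h"
          using shared[OF hF(1)] hF \<open>deg_in A F j = 2\<close> by (auto simp: shared_targets_def)
        have "x \<in> R j i" "x \<in> W j i" "\<beta> j i x = c"
          using x c rec_src by (auto simp: W_def i_def cls_def b_def)
        \<comment> \<open>\<open>i\<close> and \<open>h\<close> have equally many differing replicas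
          at \<open>j\<close>, and these come first, so the replica of \<open>h\<close> with index
          \<open>c\<close> differs as well.\<close>
        then have "c < card (W j h)"
          using \<beta>_W card_W[OF i(1) hF(1) i(2) hM] by metis
        moreover obtain y where y: "y \<in> T" "pr y = h"
          using ex_cls[OF _ c(2), of h] mem_S_src_iff[of h j] hF F j c(1) by blast
        moreover have "y \<in> R j h" "\<beta> j h y = c"
          using y c rec_src by (auto simp: cls_def b_def)
        ultimately have yU: "y \<in> U"
          using \<beta>_W by (auto simp: W_def)
        \<comment> \<open>Any differing member comes from a node of \<open>F\<close> sending to
          \<open>j\<close>, that is \<open>i\<close> or \<open>h\<close>, and the tuple has one
          object of each.\<close>
        have "T \<inter> U = {x, y}"
        proof (intro equalityI subsetI)
          fix z assume z: "z \<in> T \<inter> U"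
          then have "pr z \<in> F" "j \<in> S_tgt A (pr z)"
            using c M(1) by (auto simp: U_def cls_def rec_def)
          then have "pr z = pr x \<or> pr z = pr y"
            using h(1) y(2) i_def by blast
          then show "z \<in> {x, y}"
            using cls_unique z x(1) y(1) c(1) by blast
        qed (use x y yU in auto)
        moreover have "x \<noteq> y"
          using h y i_def by auto
        ultimately show ?thesis
          using finT by (simp add: sum.If_cases)
      qed
      then show "parity_word L w T = parity_word L w' T"
        by (auto simp: parity_word_def w_def w'_def)
    qed
    moreover obtain i where i: "i \<in> F"
      using ne by blast
    \<comment> \<open>A \<open>q\<close>-subset of \<open>M i\<close>, available as
      \<open>q \<le> m\<close>, gives an object of \<open>U\<close>, where the assignments
      differ.\<close>
    moreover obtain T where T: "T \<subseteq> M i" "card T = q" "finite T"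
      using obtain_subset_with_card_n[of q "M i"] q M(2)[OF i] by auto
    moreover have "enc i T \<in> U"
      using i T M(1) F by (auto simp: U_def Obj_def pr_enc tg_enc)
    ultimately have "w (enc i T) = w' (enc i T)"
      using rec unfolding permits_recovery_def by (auto simp: U_def)
    then have "w (enc i T) $ 0 = w' (enc i T) $ 0"
      by simp
    then show False
      using \<open>enc i T \<in> U\<close> by (simp add: w_def w'_def)
  qed
  ultimately show ?thesis
    by blast
qed

lemma ex_unrecoverable_separated:
  assumes sep: "pairwise_separated A F" and ne: "F \<noteq> {}" and q: "q \<le> lam * (card F - 1)"
  shows "\<exists>L. legal_placement A k q L \<and> \<not> permits_recovery A L F"
  by (rule ex_unrecoverable_placement[OF sep ne, where M = "shared_targets F"
        and m = "lam * (card F - 1)"])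
    (use card_shared_targets_separated[OF sep] q in \<open>auto simp: shared_targets_def\<close>)

text \<open>The private target \<open>\<sigma> i\<close> is itself failed, so no surviving parity
  checks it; it enlarges \<open>M i\<close> by one.\<close>

lemma ex_unrecoverable_private:
  assumes sep: "pairwise_separated A F" and ne: "F \<noteq> {}"
    and priv: "private_target_permutation A F" and q: "q \<le> lam * (card F - 1) + 1"
  shows "\<exists>L. legal_placement A k q L \<and> \<not> permits_recovery A L F"
proof -
  obtain \<sigma> where \<sigma>: "bij_betw \<sigma> F F"
      "\<And>i. i \<in> F \<Longrightarrow> \<sigma> i \<in> S_tgt A i" "\<And>i. i \<in> F \<Longrightarrow> deg_in A F (\<sigma> i) = 1"
    using priv by (auto simp: private_target_permutation_def)
  show ?thesis
  proof (rule ex_unrecoverable_placement[OF sep ne, where M = "\<lambda>i. insert (\<sigma> i) (shared_targets F i)"])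
    fix i assume i: "i \<in> F"
    then have "\<sigma> i \<notin> shared_targets F i"
      using \<sigma>(3) by (simp add: shared_targets_def)
    then show "card (insert (\<sigma> i) (shared_targets F i)) = lam * (card F - 1) + 1"
      using card_shared_targets_separated[OF sep i] by simp
  qed (use \<sigma> q bij_betwE[OF \<sigma>(1)] in \<open>auto simp: shared_targets_def\<close>)
qed

section \<open>The threshold as a least sufficient count\<close>

lemma q_star_eqI:
  assumes "c \<in> sufficient_counts A k p"
    and "\<And>q. q < c \<Longrightarrow> \<exists>L F. legal_placement A k q L \<and> F \<subseteq> nodes A \<and> card F \<le> p \<and>
      \<not> permits_recovery A L F"
  shows "sufficient_counts A k p \<noteq> {} \<and> q_star A k p = c"
proof -
  have "c \<le> q" if "q \<in> sufficient_counts A k p" for q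
    using assms(2)[of q] that unfolding sufficient_counts_def by (force simp: not_less[symmetric])
  then show ?thesis
    using assms(1) unfolding q_star_def by (auto intro: Least_equality)
qed

text \<open>The bound on \<open>k\<close> keeps both candidate values within the admissible counts.
  Nonemptiness is carried along because \<open>LEAST\<close> is meaningless on an empty set.\<close>

lemma q_star_separated:
  assumes p: "1 \<le> p" and k: "lam * (p - 1) + 2 \<le> k"
    and ex: "\<exists>F. pairwise_separated A F \<and> card F = p"
  shows "sufficient_counts A k p \<noteq> {} \<and>
    q_star A k p =
      (if \<exists>F. pairwise_separated A F \<and> card F = p \<and> private_target_permutation A F
       then lam * (p - 1) + 2
       else lam * (p - 1) + 1)"
proof (cases "\<exists>F. pairwise_separated A F \<and> card F = p \<and> private_target_permutation A F")
  case True
  then obtain F where F: "pairwise_separated A F" "card F = p" "private_target_permutation A F"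
    by blast
  have "F \<noteq> {}" "F \<subseteq> nodes A"
    using F p by (auto simp: pairwise_separated_def)
  then have "\<exists>L F. legal_placement A k q L \<and> F \<subseteq> nodes A \<and> card F \<le> p \<and> \<not> permits_recovery A L F"
    if "q < lam * (p - 1) + 2" for q
    using ex_unrecoverable_private[OF F(1) _ F(3), of q] F(2) that by auto
  moreover have "lam * (p - 1) + 2 \<in> sufficient_counts A k p"
    using k no_recovery_imp[of "lam * (p - 1) + 2" _ _ p] by (auto simp: sufficient_counts_def)
  ultimately show ?thesis
    using True q_star_eqI by simp
next
  case False
  obtain F where F: "pairwise_separated A F" "card F = p"
    using ex by blast
  have "F \<noteq> {}" "F \<subseteq> nodes A"
    using F p by (auto simp: pairwise_separated_def)
  then have "\<exists>L F. legal_placement A k q L \<and> F \<subseteq> nodes A \<and> card F \<le> p \<and> \<not> permits_recovery A L F"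
    if "q < lam * (p - 1) + 1" for q
    using ex_unrecoverable_separated[OF F(1), of q] F(2) that by auto
  \<comment> \<open>A failure at this count would produce the permutation that the present case
    excludes.\<close>
  moreover have "lam * (p - 1) + 1 \<in> sufficient_counts A k p"
    using k no_recovery_imp[of "lam * (p - 1) + 1" _ _ p] False
    by (auto simp: sufficient_counts_def)
  ultimately show ?thesis
    using False q_star_eqI by simp
qed

end

section \<open>From a labelled design to the matrix axioms\<close>

lemma design_matrix_representative:
  assumes design: "sbibd v k lam P B inc" and rep: "representative v P B inc A"
    and zero: "zero_diagonal A"
  shows "design_matrix v k lam A"
proof -
  obtain f g where A: "A \<in> carrier_mat v v"
    and f: "bij_betw f P {0..<v}" and g: "bij_betw g B {0..<v}"
    and A_fg: "\<And>x b. x \<in> P \<Longrightarrow> b \<in> B \<Longrightarrow> A $$ (f x, g b) = (if inc x b then 1 else 0)"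
    using rep by (auto simp: representative_def)
  have nodes: "nodes A = {0..<v}"
    using A by (auto simp: nodes_def)
  have fP: "f x < v" if "x \<in> P" for x
    using bij_betwE[OF f] that by auto
  have gB: "g b < v" if "b \<in> B" for b
    using bij_betwE[OF g] that by auto
  have ex_f: "\<exists>x\<in>P. i = f x" if "i < v" for i
    using f that by (force simp: bij_betw_def)
  have ex_g: "\<exists>b\<in>B. j = g b" if "j < v" for j
    using g that by (force simp: bij_betw_def)
  \<comment> \<open>Target sets are relabelled sets of blocks through a point, source sets
    relabelled blocks; bijective labels preserve their sizes.\<close>
  have S_tgt: "S_tgt A (f x) = g ` {b \<in> B. inc x b}" if "x \<in> P" for x
    using that A_fg gB ex_g by (fastforce simp: S_tgt_def nodes split: if_splits)
  have S_src: "S_src A (g b) = f ` {x \<in> P. inc x b}" if "b \<in> B" for b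
    using that A_fg fP ex_f by (fastforce simp: S_src_def nodes split: if_splits)
  have inj_f: "inj_on f X" if "X \<subseteq> P" for X
    using f that by (auto simp: bij_betw_def intro: inj_on_subset)
  have inj_g: "inj_on g X" if "X \<subseteq> B" for X
    using g that by (auto simp: bij_betw_def intro: inj_on_subset)
  show ?thesis
  proof
    show "A \<in> carrier_mat v v" by (rule A)
    show "1 \<le> lam" "lam < k"
      using design by (auto simp: sbibd_def)
    show "A $$ (i, i) = 0" if "i < v" for i
      using zero A that by (auto simp: zero_diagonal_def)
    show "A $$ (i, j) = 0 \<or> A $$ (i, j) = 1" if "i < v" "j < v" for i j
      using ex_f[OF that(1)] ex_g[OF that(2)] A_fg by auto
    show "card (S_src A j) = k" if "j < v" for j
      using ex_g[OF that] S_src design card_image[OF inj_f] by (fastforce simp: sbibd_def)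
    show "card (S_tgt A i) = k" if "i < v" for i
      using ex_f[OF that] S_tgt design card_image[OF inj_g] by (fastforce simp: sbibd_def)
    show "card (S_tgt A i \<inter> S_tgt A h) = lam" if ih: "i < v" "h < v" "i \<noteq> h" for i h
    proof -
      obtain x y where xy: "x \<in> P" "y \<in> P" "i = f x" "h = f y" "x \<noteq> y"
        using ex_f ih by metis
      have "S_tgt A i \<inter> S_tgt A h = g ` ({b \<in> B. inc x b} \<inter> {b \<in> B. inc y b})"
        using inj_on_image_Int[OF inj_g[OF subset_refl], of "{b \<in> B. inc x b}" "{b \<in> B. inc y b}"]
        by (simp add: xy S_tgt)
      also have "{b \<in> B. inc x b} \<inter> {b \<in> B. inc y b} = {b \<in> B. inc x b \<and> inc y b}"
        by auto
      finally have "S_tgt A i \<inter> S_tgt A h = g ` {b \<in> B. inc x b \<and> inc y b}" .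
      then show ?thesis
        using card_image[OF inj_g, of "{b \<in> B. inc x b \<and> inc y b}"] design xy
        by (auto simp: sbibd_def)
    qed
  qed
qed

theorem mainTheorem6:
  fixes p v k lam :: nat
    and P :: "'a set" and B :: "'b set" and inc :: "'a \<Rightarrow> 'b \<Rightarrow> bool"
    and A :: "nat mat"
  assumes "p \<ge> 3"
    and "sbibd v k lam P B inc"
    and "representative v P B inc A"
    and "zero_diagonal A"
    and "k \<ge> lam * (p - 1) + 2"
    and "\<exists>F. pairwise_separated A F \<and> card F = p"
  shows "sufficient_counts A k p \<noteq> {} \<and>
    q_star A k p =
      (if \<exists>F. pairwise_separated A F \<and> card F = p \<and> private_target_permutation A F
       then lam * (p - 1) + 2
       else lam * (p - 1) + 1)"
proof -
  interpret design_matrix v k lam A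
    using assms(2-4) by (rule design_matrix_representative)
  show ?thesis
    by (rule q_star_separated) (use assms in auto)
qed

end
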